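(* Let $1\le q,p<\infty$ and let $(X,\rho,\mu)$ be a metric measure space satisfying one of the following: (a) $\mu$ has polynomial growth and the functions in $C_c^*(X)$ satisfy a (weak) $(q,p)$-Poincaré inequality; or (b) $(X,\rho,\mu)$ is of homogeneous type and supports a $(q,p)$-Poincaré inequality, and $p(\cdot):X\to[1,\infty)$ is a log-Hölder continuous function. For $f\in C_c^*(X)$ put $$E(f):=\sup_{\lambda>0}\lambda^p\iint_{X\times X}\mathbf 1_{\{(x,y):\ |f(x)-f(y)|>\lambda\,\rho(x,y)\,[\mu(B(x,\rho(x,y)))]^{1/p}\}}\,d\mu(x)\,d\mu(y),\qquad S(f):=\int_X(\operatorname{Lip}f(x))^p\,d\mu(x),$$ and let $$C_{\mathrm{opt}}:=\inf_{f\in C_c^*(X)\setminus\{0\}}\frac{E(f)}{S(f)}.$$ Then there exists a sequence $\{f_k\}_{k\in\mathbb N}\subset C_c^*(X)$ such that $$\lim_{k\to\infty}\frac{E(f_k)}{S(f_k)}=C_{\mathrm{opt}},$$ and no constant $C'<C_{\mathrm{opt}}$ can serve as a uniform bound in the finite difference inequality, i.e. for no $C'<C_{\mathrm{opt}}$ does $E(g)\le C'\,S(g)$ hold for all $g\in C_c^*(X)$.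
   Context: A metric measure space $(X,\rho,\mu)$ consists of a nonempty set $X$, a metric $\rho$ on $X$ and a Borel measure $\mu$ on $X$; $B(x,r)=\{y\in X:\rho(x,y)<r\}$, and for $\tau>0$ and a ball $B=B(x_B,r_B)$, $\tau B=B(x_B,\tau r_B)$. The space is of homogeneous type if there is $C_D\ge1$ with $\mu(B(x,2r))\le C_D\,\mu(B(x,r))$ for all $x\in X$, $r>0$. The measure $\mu$ has polynomial growth if there are $C_P>0$ and $d>0$ with $\mu(B(x,r))\le C_P\,r^d$ for all $x\in X$, $r>0$. Pointwise Lipschitz constants: $\operatorname{Lip}f(x)=\limsup_{r\to0^+}\sup_{y\in B(x,r)}\frac{|f(x)-f(y)|}{r}$ and $\operatorname{lip}f(x)=\liminf_{r\to0^+}\sup_{y\in B(x,r)}\frac{|f(x)-f(y)|}{r}$. $C_c^*(X)$ is the class of Lipschitz functions $f:X\to\mathbb R$ with compact support such that $\operatorname{Lip}f$ is a continuous function with compact support and the convergence in the $\limsup$ defining $\operatorname{Lip}f$ is uniform, i.e. $\sup_{0<r<\delta}\sup_{y\in B(x,r)}\frac{|f(x)-f(y)|}{r}\to\operatorname{Lip}f(x)$ uniformly in $x\in X$ as $\delta\to0^+$. A $(q,p)$-Poincaré inequality holds for a class of Lipschitz functions if there exist constants $C_2\ge1$ and $\tau\ge1$ and a family $\{\ell_B\}$, indexed by the balls $B\subset X$, of linear functionals on the space $BC(X)$ of bounded continuous functions such that for every ball $B=B(x_B,r_B)$ and every $\varphi\in BC(X)$, $\ell_B(1)=1$ and $|\ell_B(\varphi)|\le\left[\frac1{\mu(B)}\int_B|\varphi|^q\,d\mu\right]^{1/q}$,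 and for all $f$ in the class $$\left[\frac1{\mu(B)}\int_B|f-\ell_B(f)|^q\,d\mu\right]^{1/q}\le C_2\,r_B\left[\frac1{\mu(\tau B)}\int_{\tau B}(\operatorname{lip}f)^p\,d\mu\right]^{1/p}.$$ The space supports a $(q,p)$-Poincaré inequality if this holds for the class $\mathrm{LIP}(X)$ of all Lipschitz functions on $X$. Log-Hölder continuity of $p(\cdot)$ means: there is $c>0$ with $|p(x)-p(y)|\le\frac{c}{\log(e+1/\rho(x,y))}$ for all $x\ne y$ in $X$.
   Formalization: It is assumed that C_c^*(X) contains a nonconstant function (otherwise the infimum is empty or only 0/0, e.g. X = R minus Q), and the infimum and the sequence f_k are restricted to nonzero f with S(f) ≠ 0, which only excludes nonzero constants on compact X. *)

theory Defs
  imports "HOL-Analysis.Analysis"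
begin

text \<open>
  The metric space is a type of class \<open>metric_space\<close> (so \<open>X\<close> is \<open>UNIV\<close>), and the Borel measure is
  \<open>\<mu> :: 'a measure\<close> with \<open>sets \<mu> = sets borel\<close>.  Averages and energies are \<open>[0,\<infinity>]\<close>-valued.
\<close>

text \<open>Power of an extended nonnegative number; only exponents \<open>a > 0\<close> are used.\<close>

definition epow :: "ennreal \<Rightarrow> real \<Rightarrow> ennreal" where
  "epow t a = (if t = \<infinity> then \<infinity> else ennreal (enn2real t powr a))"

definition polynomial_growth :: "'a::metric_space measure \<Rightarrow> bool" where
  "polynomial_growth \<mu> \<longleftrightarrow>
     (\<exists>C_P>0. \<exists>d>0. \<forall>x. \<forall>r>0. emeasure \<mu> (ball x r) \<le> ennreal (C_P * r powr d))"

definition homogeneous_type :: "'a::metric_space measure \<Rightarrow> bool" where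
  "homogeneous_type \<mu> \<longleftrightarrow>
     (\<exists>C_D\<ge>1. \<forall>x. \<forall>r>0. emeasure \<mu> (ball x (2 * r)) \<le> ennreal C_D * emeasure \<mu> (ball x r))"

definition log_Hoelder :: "('a::metric_space \<Rightarrow> real) \<Rightarrow> bool" where
  "log_Hoelder p \<longleftrightarrow>
     (\<exists>c>0. \<forall>x y. x \<noteq> y \<longrightarrow> \<bar>p x - p y\<bar> \<le> c / ln (exp 1 + 1 / dist x y))"

text \<open>
  The extrema are taken in \<open>ereal\<close>.  For Lipschitz \<open>f\<close>, the only case used below, they are finite,
  so that \<open>real_of_ereal\<close> is harmless.
\<close>

definition osc_quot :: "('a::metric_space \<Rightarrow> real) \<Rightarrow> 'a \<Rightarrow> real \<Rightarrow> ereal" where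
  "osc_quot f x r = (SUP y\<in>ball x r. ereal (\<bar>f x - f y\<bar> / r))"

definition Lip :: "('a::metric_space \<Rightarrow> real) \<Rightarrow> 'a \<Rightarrow> real" where
  "Lip f x = real_of_ereal (Limsup (at_right 0) (osc_quot f x))"

definition lip :: "('a::metric_space \<Rightarrow> real) \<Rightarrow> 'a \<Rightarrow> real" where
  "lip f x = real_of_ereal (Liminf (at_right 0) (osc_quot f x))"

definition LIP :: "('a::metric_space \<Rightarrow> real) set" where
  "LIP = {f. \<exists>L. L-lipschitz_on UNIV f}"

definition compact_support :: "('a::metric_space \<Rightarrow> real) \<Rightarrow> bool" where
  "compact_support f \<longleftrightarrow> compact (closure {x. f x \<noteq> 0})"

definition Cc_star :: "('a::metric_space \<Rightarrow> real) set" where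
  "Cc_star = {f \<in> LIP. compact_support f \<and> continuous_on UNIV (Lip f) \<and> compact_support (Lip f) \<and>
     uniform_limit UNIV (\<lambda>\<delta> x. real_of_ereal (SUP r\<in>{0<..<\<delta>}. osc_quot f x r)) (Lip f) (at_right 0)}"

text \<open>\<open>Lavg \<mu> s A g = ((1/\<mu>(A)) \<integral>\<^sub>A |g|\<^sup>s d\<mu>)\<^sup>1\<^sup>/\<^sup>s\<close>.\<close>

definition Lavg :: "'a measure \<Rightarrow> real \<Rightarrow> 'a set \<Rightarrow> ('a \<Rightarrow> real) \<Rightarrow> ennreal" where
  "Lavg \<mu> s A g =
     epow ((\<integral>\<^sup>+x\<in>A. ennreal (\<bar>g x\<bar> powr s) \<partial>\<mu>) / emeasure \<mu> A) (1 / s)"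

text \<open>
  Balls carry their centre and radius.  The functionals are defined on bounded continuous functions
  only, while members of \<open>F\<close> (e.g. of \<open>LIP\<close>) may be unbounded.  Since \<open>l x r \<phi>\<close> is controlled by
  the values of \<open>\<phi>\<close> on \<open>B = ball x r\<close>, the number \<open>l\<^sub>B(f)\<close> stands for \<open>l x r \<phi>\<close> with any bounded
  continuous \<open>\<phi>\<close> that agrees with \<open>f\<close> on \<open>B\<close>, for instance a truncation of \<open>f\<close>, or \<open>f\<close> itself if it
  is bounded.  Normalisation and bound of \<open>l\<close> force \<open>0 < \<mu>(B) < \<infinity>\<close>, because \<open>0/0 = \<infinity>/\<infinity> = 0\<close> in
  \<open>ennreal\<close>.
\<close>

definition Poincare ::
    "'a::metric_space measure \<Rightarrow> real \<Rightarrow> real \<Rightarrow> ('a \<Rightarrow> real) set \<Rightarrow> bool" where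
  "Poincare \<mu> q p F \<longleftrightarrow>
     (\<exists>C\<^sub>2\<ge>1. \<exists>\<tau>\<ge>1. \<exists>l :: 'a \<Rightarrow> real \<Rightarrow> ('a \<Rightarrow>\<^sub>C real) \<Rightarrow> real.
        \<forall>x. \<forall>r>0.
          linear (l x r) \<and>
          l x r (const_bcontfun 1) = 1 \<and>
          (\<forall>\<phi>. ennreal \<bar>l x r \<phi>\<bar> \<le> Lavg \<mu> q (ball x r) (apply_bcontfun \<phi>)) \<and>
          (\<forall>f\<in>F. \<forall>\<phi>. (\<forall>y\<in>ball x r. apply_bcontfun \<phi> y = f y) \<longrightarrow>
             Lavg \<mu> q (ball x r) (\<lambda>y. f y - l x r \<phi>)
               \<le> ennreal (C\<^sub>2 * r) * Lavg \<mu> p (ball x (\<tau> * r)) (lip f)))"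

definition energy_E :: "'a::metric_space measure \<Rightarrow> real \<Rightarrow> ('a \<Rightarrow> real) \<Rightarrow> ennreal" where
  "energy_E \<mu> p f =
     (SUP s\<in>{0<..}. ennreal (s powr p) *
        (\<integral>\<^sup>+y. \<integral>\<^sup>+x. indicator {(x, y). ennreal \<bar>f x - f y\<bar>
                 > ennreal (s * dist x y) * epow (emeasure \<mu> (ball x (dist x y))) (1 / p)} (x, y)
           \<partial>\<mu> \<partial>\<mu>))"

definition energy_S :: "'a::metric_space measure \<Rightarrow> real \<Rightarrow> ('a \<Rightarrow> real) \<Rightarrow> ennreal" where
  "energy_S \<mu> p f = (\<integral>\<^sup>+x. ennreal (Lip f x powr p) \<partial>\<mu>)"

text \<open>
  The nonzero functions for which the quotient \<open>E(f)/S(f)\<close> is meaningful.  Under a Poincare inequality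
  \<open>S(f) = 0\<close> holds only for constant \<open>f\<close>, so the second condition removes nothing unless \<open>X\<close> is
  compact, when it removes the nonzero constants, whose quotient is \<open>0/0\<close>.
\<close>

definition quot_dom :: "'a::metric_space measure \<Rightarrow> real \<Rightarrow> ('a \<Rightarrow> real) set" where
  "quot_dom \<mu> p = {f \<in> Cc_star - {\<lambda>_. 0}. energy_S \<mu> p f \<noteq> 0}"

definition C_opt :: "'a::metric_space measure \<Rightarrow> real \<Rightarrow> ennreal" where
  "C_opt \<mu> p = (INF f\<in>quot_dom \<mu> p. energy_E \<mu> p f / energy_S \<mu> p f)"

end

theory Submission
  imports Defs
begin

text \<open>
  An infimum over a nonempty set of extended numbers is the limit of a sequence from that set, and a
  bound for one quotient is a bound for the infimum.  So everything rests on one analytic fact: a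
  nonconstant \<open>f\<close> of the class has \<open>S(f) \<noteq> 0\<close> (\<open>energy_S_nonzero\<close>), and therefore the set of
  admissible functions is nonempty.

  This fact comes from the Poincare inequality.  If \<open>S(f) = 0\<close>, then, since \<open>lip f \<le> Lip f\<close>, the
  right-hand side of the inequality vanishes on every ball \<open>B\<close>, so that \<open>f\<close> agrees almost everywhere
  on \<open>B\<close> with the number \<open>\<ell>\<^sub>B(f)\<close>.  The normalisation \<open>\<ell>\<^sub>B(1) = 1\<close> forces every ball to have positive
  and finite measure (\<open>Lavg_one_le_imp\<close>), so a continuous function that is almost everywhere
  constant on \<open>B\<close> is constant on \<open>B\<close>.  Any two points lie in a common ball, and \<open>f\<close> is constant.

  For the second assertion, \<open>E(f) \<le> C' S(f)\<close> with \<open>S(f) \<noteq> 0\<close> excludes \<open>C' < 0\<close>; for \<open>C' \<ge> 0\<close> it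
  bounds the quotient by \<open>C'\<close>, also when \<open>S(f) = \<infinity>\<close>, because the quotient is then \<open>0\<close>.
\<close>

section \<open>Pointwise Lipschitz constants\<close>

lemma osc_quot_nonneg:
  assumes "r > 0"
  shows "0 \<le> osc_quot f x r"
  unfolding osc_quot_def
  by (rule SUP_upper2[of x]) (use assms in auto)

lemma osc_quot_le:
  assumes f: "L-lipschitz_on UNIV f" and r: "r > 0"
  shows "osc_quot f x r \<le> ereal L"
  unfolding osc_quot_def
proof (rule SUP_least)
  fix y assume y: "y \<in> ball x r"
  have "\<bar>f x - f y\<bar> \<le> L * dist x y"
    using lipschitz_onD[OF f, of x y] by (simp add: dist_real_def)
  also have "\<dots> \<le> L * r"
    using y lipschitz_on_nonneg[OF f] by (intro mult_left_mono) auto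
  finally show "ereal (\<bar>f x - f y\<bar> / r) \<le> ereal L"
    using r by (simp add: field_simps)
qed

text \<open>
  The Lipschitz bound matters because \<^const>\<open>real_of_ereal\<close> sends \<open>\<infinity>\<close> to \<open>0\<close>: monotonicity is only
  available for finite values.
\<close>

lemma lip_bounds:
  assumes "f \<in> LIP"
  shows "0 \<le> lip f x" and "lip f x \<le> Lip f x"
proof -
  obtain L where L: "L-lipschitz_on UNIV f"
    using assms by (auto simp: LIP_def)
  have ev: "eventually (\<lambda>r::real. r > 0) (at_right 0)"
    by (simp add: eventually_at_right_less)
  let ?i = "Liminf (at_right 0) (osc_quot f x)" and ?s = "Limsup (at_right 0) (osc_quot f x)"
  have 0: "0 \<le> ?i"
    by (rule Liminf_bounded, rule eventually_mono[OF ev]) (rule osc_quot_nonneg)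
  have le: "?i \<le> ?s"
    by (rule Liminf_le_Limsup) simp
  have s: "?s \<le> ereal L"
    by (rule Limsup_bounded, rule eventually_mono[OF ev]) (rule osc_quot_le[OF L])
  show "0 \<le> lip f x"
    unfolding lip_def using 0 by (rule real_of_ereal_pos)
  have "\<bar>?s\<bar> \<noteq> \<infinity>"
    using 0 le s by (cases ?s) auto
  then show "lip f x \<le> Lip f x"
    unfolding lip_def Lip_def using 0 le by (intro real_of_ereal_positive_mono) auto
qed

section \<open>Averages\<close>

lemma epow_zero [simp]: "epow 0 a = 0"
  by (simp add: epow_def)

lemma epow_eq_0D: "epow t a = 0 \<Longrightarrow> t = 0"
  by (auto simp: epow_def enn2real_eq_0_iff powr_nonneg_iff top_unique split: if_splits)

text \<open>
  In \<^typ>\<open>ennreal\<close> both \<open>0 / 0\<close> and \<open>\<infinity> / \<infinity>\<close> are \<open>0\<close>, so the average of the constant \<open>1\<close> vanishes over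
  a set of measure \<open>0\<close> or \<open>\<infinity>\<close>.
\<close>

lemma Lavg_one_le_imp:
  assumes A: "A \<in> sets \<mu>" and le: "1 \<le> Lavg \<mu> s A (\<lambda>_. 1)"
  shows "emeasure \<mu> A \<noteq> 0" and "emeasure \<mu> A \<noteq> \<infinity>"
proof -
  have "Lavg \<mu> s A (\<lambda>_. 1) = epow (emeasure \<mu> A / emeasure \<mu> A) (1 / s)"
    using A by (simp add: Lavg_def)
  then have "emeasure \<mu> A / emeasure \<mu> A \<noteq> 0"
    using le by (metis epow_zero not_one_le_zero)
  then show "emeasure \<mu> A \<noteq> 0" and "emeasure \<mu> A \<noteq> \<infinity>"
    by (auto simp: ennreal_divide_top)
qed

lemma Lavg_eq_0_imp_AE:
  assumes A: "A \<in> sets \<mu>" and fin: "emeasure \<mu> A \<noteq> \<infinity>"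
    and g: "g \<in> borel_measurable \<mu>" and 0: "Lavg \<mu> s A g = 0"
  shows "AE x in \<mu>. x \<in> A \<longrightarrow> g x = 0"
proof -
  have "(\<integral>\<^sup>+x\<in>A. ennreal (\<bar>g x\<bar> powr s) \<partial>\<mu>) = 0"
    using epow_eq_0D[OF 0[unfolded Lavg_def]] fin by (simp add: ennreal_divide_eq_0_iff)
  then have "AE x in \<mu>. ennreal (\<bar>g x\<bar> powr s) * indicator A x = 0"
    using A g by (subst (asm) nn_integral_0_iff_AE) auto
  then show ?thesis
    by (rule AE_mp) (auto intro!: AE_I2 split: split_indicator simp: ennreal_eq_0_iff)
qed

text \<open>
  The part of \<open>U\<close> on which \<open>f \<noteq> c\<close> is open, so it would contain a ball if it were nonempty, and a
  ball is not a null set.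
\<close>

lemma AE_const_on_open_imp_const:
  fixes \<mu> :: "'a::metric_space measure" and f :: "'a \<Rightarrow> real"
  assumes sets: "sets \<mu> = sets borel"
    and pos: "\<And>x r. r > 0 \<Longrightarrow> emeasure \<mu> (ball x r) \<noteq> 0"
    and cont: "continuous_on UNIV f" and U: "open U"
    and AE: "AE x in \<mu>. x \<in> U \<longrightarrow> f x = c" and y: "y \<in> U"
  shows "f y = c"
proof (rule ccontr)
  assume "f y \<noteq> c"
  moreover have "open (U \<inter> {x. f x \<noteq> c})"
    using U cont by (intro open_Int open_Collect_neq) auto
  ultimately obtain e where e: "e > 0" "ball y e \<subseteq> U \<inter> {x. f x \<noteq> c}"
    using y by (auto elim!: openE)
  have "AE x in \<mu>. x \<notin> ball y e"
    using AE by (rule AE_mp) (use e in \<open>auto intro!: AE_I2\<close>)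
  moreover have "ball y e \<in> sets \<mu>"
    by (simp add: sets)
  ultimately have "emeasure \<mu> (ball y e) = 0"
    using AE_iff_measurable[of "ball y e" \<mu> "\<lambda>x. x \<notin> ball y e"] sets.sets_into_space by blast
  then show False
    using pos e by blast
qed

section \<open>The energy of a nonconstant function\<close>

lemma Cc_star_LIP: "Cc_star \<subseteq> LIP"
  by (auto simp: Cc_star_def)

lemma Cc_star_continuous:
  assumes "f \<in> Cc_star"
  shows "continuous_on UNIV f"
  using assms by (auto simp: Cc_star_def LIP_def intro: lipschitz_on_continuous_on)

lemma Cc_star_bcontfun:
  assumes "f \<in> Cc_star"
  shows "f \<in> bcontfun"
proof -
  let ?K = "closure {x. f x \<noteq> 0}"
  have "compact ?K"
    using assms by (auto simp: Cc_star_def compact_support_def)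
  then have "bounded (insert 0 (f ` ?K))"
    using Cc_star_continuous[OF assms]
    by (auto intro!: compact_imp_bounded compact_continuous_image intro: continuous_on_subset)
  moreover have "range f \<subseteq> insert 0 (f ` ?K)"
    using closure_subset[of "{x. f x \<noteq> 0}"] by auto
  ultimately have "bounded (range f)"
    by (rule bounded_subset)
  then show ?thesis
    using Cc_star_continuous[OF assms] by (simp add: bcontfun_def)
qed

lemma Lavg_lip_eq_0:
  assumes f: "f \<in> LIP" and p: "0 \<le> p" and S: "energy_S \<mu> p f = 0"
  shows "Lavg \<mu> p A (lip f) = 0"
proof -
  have "(\<integral>\<^sup>+x\<in>A. ennreal (\<bar>lip f x\<bar> powr p) \<partial>\<mu>) \<le> energy_S \<mu> p f"
    unfolding energy_S_def
    using lip_bounds[OF f] p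
    by (intro nn_integral_mono) (auto split: split_indicator intro!: ennreal_leI powr_mono2)
  then show ?thesis
    using S by (simp add: Lavg_def)
qed

text \<open>
  Since \<open>f\<close> is itself bounded and continuous, \<open>\<ell>\<^sub>B(f)\<close> can be taken literally.  One ball that contains
  both \<open>x\<close> and \<open>y\<close> suffices for the inequality, while the positivity of the measure is used for the
  small balls around points where \<open>f\<close> differs from \<open>\<ell>\<^sub>B(f)\<close>.
\<close>

lemma energy_S_nonzero:
  fixes \<mu> :: "'a::metric_space measure"
  assumes p: "0 \<le> p" and sets: "sets \<mu> = sets borel" and P: "Poincare \<mu> q p F"
    and f: "f \<in> Cc_star" and fF: "f \<in> F" and xy: "f x \<noteq> f y"
  shows "energy_S \<mu> p f \<noteq> 0"
proof
  assume S: "energy_S \<mu> p f = 0"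
  obtain C \<tau> and l :: "'a \<Rightarrow> real \<Rightarrow> ('a \<Rightarrow>\<^sub>C real) \<Rightarrow> real"
    where l: "\<forall>x. \<forall>r>0.
      linear (l x r) \<and> l x r (const_bcontfun 1) = 1 \<and>
      (\<forall>\<phi>. ennreal \<bar>l x r \<phi>\<bar> \<le> Lavg \<mu> q (ball x r) (apply_bcontfun \<phi>)) \<and>
      (\<forall>f\<in>F. \<forall>\<phi>. (\<forall>y\<in>ball x r. apply_bcontfun \<phi> y = f y) \<longrightarrow>
         Lavg \<mu> q (ball x r) (\<lambda>y. f y - l x r \<phi>)
           \<le> ennreal (C * r) * Lavg \<mu> p (ball x (\<tau> * r)) (lip f))"
    using P unfolding Poincare_def by (elim exE conjE)
  note one = l[rule_format, THEN conjunct2, THEN conjunct1]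
    and bound = l[rule_format, THEN conjunct2, THEN conjunct2, THEN conjunct1, rule_format]
    and ineq = l[rule_format, THEN conjunct2, THEN conjunct2, THEN conjunct2, rule_format]
  have ball: "ball z r \<in> sets \<mu>" for z r
    by (simp add: sets)
  have "1 \<le> Lavg \<mu> q (ball z r) (\<lambda>_. 1)" if "r > 0" for z r
    using bound[OF that, of z "const_bcontfun 1"] one[OF that]
    by (simp add: const_bcontfun.rep_eq)
  note pos = Lavg_one_le_imp[OF ball this]
  \<comment> \<open>Balls are open, so the radius must exceed the distance for \<open>y\<close> to lie in the ball.\<close>
  define r where "r = dist x y + 1"
  have r: "r > 0" and in_ball: "x \<in> ball x r" "y \<in> ball x r"
    by (auto simp: r_def add_nonneg_pos)
  define c where "c = l x r (Bcontfun f)"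
  have "Lavg \<mu> q (ball x r) (\<lambda>y. f y - c) \<le> 0"
    using ineq[OF r fF, of x "Bcontfun f"] f Lavg_lip_eq_0[OF _ p S] Cc_star_LIP
    by (auto simp: c_def Bcontfun_inverse[OF Cc_star_bcontfun])
  moreover have "(\<lambda>y. f y - c) \<in> borel_measurable \<mu>"
    unfolding measurable_cong_sets[OF sets refl]
    by (intro borel_measurable_continuous_onI continuous_intros Cc_star_continuous f)
  ultimately have "AE z in \<mu>. z \<in> ball x r \<longrightarrow> f z - c = 0"
    using pos(2)[OF r] by (intro Lavg_eq_0_imp_AE[OF ball]) auto
  then have "AE z in \<mu>. z \<in> ball x r \<longrightarrow> f z = c"
    by simp
  then have "f z = c" if "z \<in> ball x r" for z
    using AE_const_on_open_imp_const[OF sets pos(1) Cc_star_continuous[OF f] open_ball _ that]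
    by blast
  then show False
    using xy in_ball by simp
qed

section \<open>The optimal constant\<close>

text \<open>
  The constant may a priori be negative, which is why the hypothesis is stated in \<^typ>\<open>ereal\<close>; the sign
  of \<open>a\<close> rules this out.  If \<open>b = \<infinity>\<close>, the quotient is \<open>0\<close> whatever \<open>a\<close> is.
\<close>

lemma ennreal_quotient_le:
  fixes a b :: ennreal and c :: real
  assumes le: "enn2ereal a \<le> ereal c * enn2ereal b" and b: "b \<noteq> 0"
  shows "enn2ereal (a / b) \<le> ereal c"
proof -
  have b': "0 < enn2ereal b"
    using b by (metis enn2ereal_nonneg enn2ereal_inject less_le zero_ennreal.rep_eq)
  have "0 \<le> ereal c * enn2ereal b"
    using le enn2ereal_nonneg order_trans by blast
  then have c: "0 \<le> c"
    using b' by (auto simp: ereal_zero_le_0_iff)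
  then have "enn2ereal a \<le> enn2ereal (ennreal c * b)"
    using le by (simp add: times_ennreal.rep_eq enn2ereal_ennreal)
  then have "a \<le> ennreal c * b"
    by (simp add: less_eq_ennreal.rep_eq)
  then have "a / b \<le> ennreal c"
    using b by (cases "b = \<infinity>")
      (auto simp: ennreal_divide_top divide_le_posI_ennreal mult.commute zero_less_iff_neq_zero)
  then show ?thesis
    using c by (simp add: less_eq_ennreal.rep_eq enn2ereal_ennreal)
qed

theorem theorem5p3:
  fixes \<mu> :: "'a::metric_space measure" and p q :: real and pv :: "'a \<Rightarrow> real"
  assumes "1 \<le> q" and "1 \<le> p"
    and "sets \<mu> = sets borel"
    and "(polynomial_growth \<mu> \<and> Poincare \<mu> q p Cc_star) \<or>
         (homogeneous_type \<mu> \<and> Poincare \<mu> q p LIP \<and> (\<forall>x. 1 \<le> pv x) \<and> log_Hoelder pv)"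
    and "\<exists>f\<in>(Cc_star :: ('a \<Rightarrow> real) set). \<exists>x y. f x \<noteq> f y"
  shows "(\<exists>f :: nat \<Rightarrow> 'a \<Rightarrow> real.
            (\<forall>k. f k \<in> quot_dom \<mu> p) \<and>
            (\<lambda>k. energy_E \<mu> p (f k) / energy_S \<mu> p (f k)) \<longlonglongrightarrow> C_opt \<mu> p) \<and>
         (\<forall>C' :: real. ereal C' < enn2ereal (C_opt \<mu> p) \<longrightarrow>
            \<not> (\<forall>g\<in>Cc_star. enn2ereal (energy_E \<mu> p g) \<le> ereal C' * enn2ereal (energy_S \<mu> p g)))"
proof -
  obtain f0 :: "'a \<Rightarrow> real" and x y where f0_star: "f0 \<in> Cc_star" and f0_neq: "f0 x \<noteq> f0 y"
    using assms(5) by blast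
  have "\<exists>F. Poincare \<mu> q p F \<and> f0 \<in> F"
    using assms(4) f0_star Cc_star_LIP by blast
  then have "energy_S \<mu> p f0 \<noteq> 0"
    using energy_S_nonzero[OF _ assms(3) _ f0_star _ f0_neq] assms(2) by force
  then have f0: "f0 \<in> quot_dom \<mu> p"
    using f0_star f0_neq by (auto simp: quot_dom_def)
  let ?Q = "\<lambda>f. energy_E \<mu> p f / energy_S \<mu> p f"
  obtain u where u: "\<And>n. u n \<in> ?Q ` quot_dom \<mu> p" "u \<longlonglongrightarrow> C_opt \<mu> p"
    using Inf_as_limit[of "?Q ` quot_dom \<mu> p"] f0 unfolding C_opt_def by blast
  then obtain f where f: "\<And>k. f k \<in> quot_dom \<mu> p" "\<And>k. u k = ?Q (f k)"
    unfolding image_iff by metis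
  have "u = (\<lambda>k. ?Q (f k))"
    using f(2) by auto
  then have "\<exists>f. (\<forall>k. f k \<in> quot_dom \<mu> p) \<and> (\<lambda>k. ?Q (f k)) \<longlonglongrightarrow> C_opt \<mu> p"
    using f(1) u(2) by blast
  moreover have "enn2ereal (C_opt \<mu> p) \<le> ereal C'"
    if "\<forall>g\<in>Cc_star. enn2ereal (energy_E \<mu> p g) \<le> ereal C' * enn2ereal (energy_S \<mu> p g)" for C'
  proof -
    have "C_opt \<mu> p \<le> ?Q f0"
      unfolding C_opt_def using f0 by (rule INF_lower)
    moreover have "enn2ereal (?Q f0) \<le> ereal C'"
      using that f0 by (intro ennreal_quotient_le) (auto simp: quot_dom_def)
    ultimately show ?thesis
      by (metis less_eq_ennreal.rep_eq order_trans)
  qed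
  ultimately show ?thesis
    by (metis not_le)
qed

end
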